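(* Assume the generic condition: the $N_R$ nonzero eigenvalues $b_1,\dots,b_{N_R}$ of $B$ (counted with multiplicity) are pairwise distinct. Then all the high-loss eigenvalues $\zeta_j(\beta)$, $1\le j\le N_R$ (counting multiplicities), of the system operator $A(\beta)$ satisfy, for all sufficiently large $\beta$, $$\operatorname{Re}\zeta_j(\beta)=0,\qquad 1\le j\le N_R .$$ Moreover, if in addition $\operatorname{Ker}R\cap\operatorname{Ker}\eta=\{0\}$, then the low-loss eigenvalues $\zeta_j(\beta)$, $N_R+1\le j\le 2N$ (counting multiplicities), indexed so that $\rho_j=0$ for $N_R+1\le j\le 2N_R$ and $\rho_j\neq0$ for $2N_R+1\le j\le 2N$, satisfy $$\operatorname{Re}\zeta_j(\beta)\neq 0\ \text{ for all sufficiently large }\beta,\qquad 2N_R+1\le j\le 2N;$$ $$\lim_{\beta\to\infty}\operatorname{Re}\zeta_j(\beta)=0,\qquad N_R+1\le j\le 2N_R .$$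
   Context: Setting. $N\ge 1$; $\alpha,\eta,\theta,R$ are real $N\times N$ matrices with $\alpha^{\mathrm T}=\alpha>0$, $\eta^{\mathrm T}=\eta\ge0$, $\theta^{\mathrm T}=-\theta$, $R^{\mathrm T}=R\ge0$, and $N_R=\operatorname{rank}R>0$. $\beta\ge0$ is the loss parameter. $\sqrt{\cdot}$ denotes the positive semidefinite square root. On $H=\mathbb C^{2N}=\mathbb C^N\oplus\mathbb C^N$ (standard inner product) set $$\Omega=\begin{bmatrix}-2\mathrm i\sqrt\alpha^{-1}\theta\sqrt\alpha^{-1} & -\mathrm i\Phi^{\mathrm T}\\ \mathrm i\Phi&0\end{bmatrix},\quad \Phi=\sqrt\eta\sqrt\alpha^{-1},\quad B=\begin{bmatrix}\sqrt\alpha^{-1}R\sqrt\alpha^{-1}&0\\0&0\end{bmatrix},\quad A(\beta)=\Omega-\mathrm i\beta B$$ ($A(\beta)$ is the system operator; $\Omega$ is Hermitian, $B\ge0$, $\operatorname{rank}B=N_R$). Let $0<b_1\le\dots\le b_{N_R}$ be the nonzero eigenvalues of $B$ with multiplicity (equivalently of $\alpha^{-1}R$), $P_B^\perp$ the orthogonal projection onto $\operatorname{Ker}B$, and $\Omega_1=P_B^\perp\Omega P_B^\perp|_{\operatorname{Ker}B}:\operatorname{Ker}B\to\operatorname{Ker}B$. High-loss and low-loss eigenvalues (known facts). There is an orthonormal basis $\{\mathring w_j\}_{j=1}^{2N}$ of $H$ with $B\mathring w_j=b_j\mathring w_j$ for $1\le j\le N_R$, and $\mathring w_j\in\operatorname{Ker}B$,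 $\Omega_1\mathring w_j=\rho_j\mathring w_j$ for $N_R+1\le j\le 2N$, such that for all sufficiently large $\beta$ the operator $A(\beta)$ has a basis of eigenvectors $w_j(\beta)$, $A(\beta)w_j(\beta)=\zeta_j(\beta)w_j(\beta)$, $1\le j\le 2N$, where all $w_j(\beta)=\mathring w_j+O(\beta^{-1})$ are given by convergent power series in $\beta^{-1}$, and: (high-loss, $1\le j\le N_R$) $\zeta_j(\beta)=-\mathrm i b_j\beta+\rho_j+O(\beta^{-1})$ is a convergent Laurent series in $\beta^{-1}$ with a simple pole at $\beta^{-1}=0$, $\rho_j=(\mathring w_j,\Omega\mathring w_j)$; (low-loss, $N_R+1\le j\le 2N$) $\zeta_j(\beta)=\rho_j-\mathrm i d_j\beta^{-1}+O(\beta^{-2})$ is a convergent power series in $\beta^{-1}$, $d_j\ge0$. If $\operatorname{Ker}R\cap\operatorname{Ker}\eta=\{0\}$, then exactly $N_R$ of the numbers $\rho_j$, $N_R+1\le j\le 2N$, are zero. *)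

theory Defs
  imports "HOL-Analysis.Analysis"
begin

definition pos_semidef :: "real^'n^'n \<Rightarrow> bool" where
  "pos_semidef M \<longleftrightarrow> transpose M = M \<and> (\<forall>x. 0 \<le> x \<bullet> (M *v x))"

definition pos_def :: "real^'n^'n \<Rightarrow> bool" where
  "pos_def M \<longleftrightarrow> transpose M = M \<and> (\<forall>x. x \<noteq> 0 \<longrightarrow> 0 < x \<bullet> (M *v x))"

text \<open>A positive semidefinite matrix has exactly one positive semidefinite square root;
  the value is unspecified for other arguments.\<close>

definition psd_sqrt :: "real^'n^'n \<Rightarrow> real^'n^'n" where
  "psd_sqrt M = (THE S. pos_semidef S \<and> S ** S = M)"

definition mat_ker :: "'a::semiring_1^'n^'m \<Rightarrow> ('a^'n) set" where
  "mat_ker M = {x. M *v x = 0}"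

definition four_blocks ::
  "'a^'n^'n \<Rightarrow> 'a^'n^'n \<Rightarrow> 'a^'n^'n \<Rightarrow> 'a^'n^'n \<Rightarrow> 'a^('n + 'n)^('n + 'n)" where
  "four_blocks M11 M12 M21 M22 = (\<chi> i j.
     case i of
       Inl k \<Rightarrow> (case j of Inl l \<Rightarrow> M11 $ k $ l | Inr l \<Rightarrow> M12 $ k $ l)
     | Inr k \<Rightarrow> (case j of Inl l \<Rightarrow> M21 $ k $ l | Inr l \<Rightarrow> M22 $ k $ l))"

text \<open>The complex multiple of a real matrix. (The library's scalar multiplications on the
  type of complex matrices are multiplication by a real number and the scaling of a vector
  whose scalars are themselves the entries, neither of which applies here.)\<close>

definition cscale :: "complex \<Rightarrow> real^'n^'m \<Rightarrow> complex^'n^'m" where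
  "cscale c M = map_matrix (\<lambda>x. c * complex_of_real x) M"

text \<open>The standard Hermitian inner product, linear in the second argument. The library's
  inner product on this type is its real part.\<close>

definition cinner :: "complex^'m \<Rightarrow> complex^'m \<Rightarrow> complex" where
  "cinner x y = (\<Sum>i\<in>UNIV. cnj (x $ i) * y $ i)"

definition orth_proj :: "(complex^'m) set \<Rightarrow> complex^'m \<Rightarrow> complex^'m" where
  "orth_proj V x = (THE y. y \<in> V \<and> (\<forall>z\<in>V. cinner z (x - y) = 0))"

definition Phi_mat :: "real^'n^'n \<Rightarrow> real^'n^'n \<Rightarrow> real^'n^'n" where
  "Phi_mat \<alpha> \<eta> = psd_sqrt \<eta> ** matrix_inv (psd_sqrt \<alpha>)"

definition Omega_mat ::
  "real^'n^'n \<Rightarrow> real^'n^'n \<Rightarrow> real^'n^'n \<Rightarrow> complex^('n + 'n)^('n + 'n)" where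
  "Omega_mat \<alpha> \<eta> \<theta> = four_blocks
     (cscale (- 2 * \<i>) (matrix_inv (psd_sqrt \<alpha>) ** \<theta> ** matrix_inv (psd_sqrt \<alpha>)))
     (cscale (- \<i>) (transpose (Phi_mat \<alpha> \<eta>)))
     (cscale \<i> (Phi_mat \<alpha> \<eta>))
     0"

definition B_mat :: "real^'n^'n \<Rightarrow> real^'n^'n \<Rightarrow> complex^('n + 'n)^('n + 'n)" where
  "B_mat \<alpha> R = four_blocks
     (cscale 1 (matrix_inv (psd_sqrt \<alpha>) ** R ** matrix_inv (psd_sqrt \<alpha>))) 0 0 0"

definition system_op ::
  "real^'n^'n \<Rightarrow> real^'n^'n \<Rightarrow> real^'n^'n \<Rightarrow> real^'n^'n \<Rightarrow> real \<Rightarrow> complex^('n + 'n)^('n + 'n)" where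
  "system_op \<alpha> \<eta> \<theta> R \<beta> =
     Omega_mat \<alpha> \<eta> \<theta> - map_matrix (\<lambda>z. \<i> * complex_of_real \<beta> * z) (B_mat \<alpha> R)"

text \<open>The operator of interest is the restriction of this function to the kernel of \<open>B\<close>.\<close>

definition Omega1 ::
  "real^'n^'n \<Rightarrow> real^'n^'n \<Rightarrow> real^'n^'n \<Rightarrow> real^'n^'n \<Rightarrow> complex^('n + 'n) \<Rightarrow> complex^('n + 'n)" where
  "Omega1 \<alpha> \<eta> \<theta> R x =
     (let P = orth_proj (mat_ker (B_mat \<alpha> R)) in P (Omega_mat \<alpha> \<eta> \<theta> *v P x))"

text \<open>Geometric and algebraic multiplicity agree for the Hermitian matrices \<open>B\<close> to which
  this is applied.\<close>

definition enumerates_nonzero_eigenvalues ::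
  "complex^'m^'m \<Rightarrow> nat \<Rightarrow> (nat \<Rightarrow> real) \<Rightarrow> bool" where
  "enumerates_nonzero_eigenvalues M n b \<longleftrightarrow>
     (\<forall>j\<in>{1..n}. 0 < b j) \<and> mono_on {1..n} b \<and>
     (\<forall>\<mu>::complex. \<mu> \<noteq> 0 \<longrightarrow>
        card {j \<in> {1..n}. complex_of_real (b j) = \<mu>} = vec.dim {x. M *v x = \<mu> *s x})"

definition expands_in_inverse_powers ::
  "(real \<Rightarrow> 'a::real_normed_vector) \<Rightarrow> (nat \<Rightarrow> 'a) \<Rightarrow> bool" where
  "expands_in_inverse_powers f a \<longleftrightarrow>
     (\<forall>\<^sub>F \<beta> in at_top. (\<lambda>k. (1 / \<beta>) ^ k *\<^sub>R a k) sums f \<beta>)"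

text \<open>\<open>loss_eigensystem \<alpha> \<eta> \<theta> R b \<rho> wr w \<zeta>\<close>: for large \<open>\<beta>\<close> the \<open>w j \<beta>\<close> form an eigenbasis of
  \<open>system_op \<alpha> \<eta> \<theta> R \<beta>\<close> with eigenvalues \<open>\<zeta> j \<beta>\<close>, so the \<open>\<zeta> j \<beta>\<close> are its eigenvalues counted with
  multiplicity. The indices \<open>1, \<dots>, rank R\<close> are the high-loss ones and the remaining ones, up to
  twice the size of the matrices, are the low-loss ones. The \<open>O\<close>-terms of the expansions are the
  tails of the convergent series.\<close>

definition loss_eigensystem ::
  "real^'n^'n \<Rightarrow> real^'n^'n \<Rightarrow> real^'n^'n \<Rightarrow> real^'n^'n \<Rightarrow> (nat \<Rightarrow> real) \<Rightarrow> (nat \<Rightarrow> real) \<Rightarrow>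
   (nat \<Rightarrow> complex^('n + 'n)) \<Rightarrow> (nat \<Rightarrow> real \<Rightarrow> complex^('n + 'n)) \<Rightarrow>
   (nat \<Rightarrow> real \<Rightarrow> complex) \<Rightarrow> bool" where
  "loss_eigensystem \<alpha> \<eta> \<theta> R b \<rho> wr w \<zeta> \<longleftrightarrow>
    (let m = rank R; n = 2 * CARD('n); B = B_mat \<alpha> R in
      enumerates_nonzero_eigenvalues B m b \<and>
      (\<forall>i\<in>{1..n}. \<forall>j\<in>{1..n}. cinner (wr i) (wr j) = (if i = j then 1 else 0)) \<and>
      (\<forall>j\<in>{1..m}. B *v wr j = complex_of_real (b j) *s wr j) \<and>
      (\<forall>j\<in>{m+1..n}. wr j \<in> mat_ker B \<and>
         Omega1 \<alpha> \<eta> \<theta> R (wr j) = complex_of_real (\<rho> j) *s wr j) \<and>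
      (\<forall>\<^sub>F \<beta> in at_top.
         inj_on (\<lambda>j. w j \<beta>) {1..n} \<and>
         vec.independent ((\<lambda>j. w j \<beta>) ` {1..n}) \<and>
         vec.span ((\<lambda>j. w j \<beta>) ` {1..n}) = UNIV \<and>
         (\<forall>j\<in>{1..n}. system_op \<alpha> \<eta> \<theta> R \<beta> *v w j \<beta> = \<zeta> j \<beta> *s w j \<beta>)) \<and>
      (\<forall>j\<in>{1..n}. \<exists>c. c 0 = wr j \<and> expands_in_inverse_powers (w j) c) \<and>
      (\<forall>j\<in>{1..m}.
         complex_of_real (\<rho> j) = cinner (wr j) (Omega_mat \<alpha> \<eta> \<theta> *v wr j) \<and>
         (\<exists>a. a 0 = complex_of_real (\<rho> j) \<and>
            expands_in_inverse_powers
              (\<lambda>\<beta>. \<zeta> j \<beta> + \<i> * complex_of_real (b j) * complex_of_real \<beta>) a)) \<and>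
      (\<forall>j\<in>{m+1..n}. \<exists>a d. 0 \<le> d \<and>
         a 0 = complex_of_real (\<rho> j) \<and> a 1 = - \<i> * complex_of_real d \<and>
         expands_in_inverse_powers (\<zeta> j) a))"

end

theory Submission
  imports Defs
begin

text \<open>Both \<open>i\<Omega>\<close> and \<open>B\<close> are real matrices, so \<open>- cnj (A \<beta>) = A \<beta>\<close> and the spectrum of
  \<open>A \<beta>\<close> is invariant under the reflection \<open>\<zeta> \<mapsto> - cnj \<zeta>\<close> in the imaginary axis. This reflection
  preserves the leading term \<open>- i b\<^sub>j \<beta>\<close> of a high-loss eigenvalue. When the \<open>b\<^sub>j\<close> are distinct,
  no other eigenvalue has this leading term, so the reflected eigenvalue is the eigenvalue itself.
  For the low-loss eigenvalues, the real part converges to \<open>\<rho>\<^sub>j\<close>.\<close>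

text \<open>Convergence at a single positive \<open>1 / \<beta>\<close> already yields a power
  series \<open>g\<close> on the complex disc of that radius, and a power series is continuous at
  its centre.\<close>

lemma expands_in_inverse_powers_tendsto:
  fixes f :: "real \<Rightarrow> complex"
  assumes "expands_in_inverse_powers f a"
  shows "(f \<longlongrightarrow> a 0) at_top"
proof -
  define g where "g z = (\<Sum>k. a k * z ^ k)" for z :: complex
  have sums: "\<forall>\<^sub>F \<beta> in at_top. (\<lambda>k. a k * complex_of_real (1 / \<beta>) ^ k) sums f \<beta>"
    using assms unfolding expands_in_inverse_powers_def scaleR_conv_of_real of_real_power
    by (simp add: mult.commute)
  then obtain \<beta> where \<beta>: "\<beta> > 0" and "(\<lambda>k. a k * complex_of_real (1 / \<beta>) ^ k) sums f \<beta>"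
    using eventually_happens[OF eventually_conj[OF eventually_gt_at_top[of 0] sums]] by auto
  then have "summable (\<lambda>k. a k * z ^ k)" if "norm z < 1 / \<beta>" for z
    using that powser_inside[of a "complex_of_real (1 / \<beta>)" z] by (auto simp: norm_divide sums_iff)
  then have "(g \<longlongrightarrow> a 0) (at 0)"
    using \<beta> by (intro powser_limit_0[of "1 / \<beta>"]) (auto simp: g_def summable_sums)
  \<comment> \<open>The filter \<open>at 0\<close> is punctured, so \<open>1 / \<beta>\<close> must
    tend to 0 and also eventually avoid 0.\<close>
  moreover have "filterlim (\<lambda>\<beta>. complex_of_real (1 / \<beta>)) (at 0) at_top"
  proof -
    have "((\<lambda>\<beta>::real. 1 / \<beta>) \<longlongrightarrow> 0) at_top"
      by (intro tendsto_divide_0[OF tendsto_const] filterlim_at_top_imp_at_infinity filterlim_ident)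
    then have "((\<lambda>\<beta>. complex_of_real (1 / \<beta>)) \<longlongrightarrow> 0) at_top"
      using tendsto_of_real_iff[where 'a = complex, of "\<lambda>\<beta>. 1 / \<beta>" 0 at_top] by simp
    moreover have "\<forall>\<^sub>F \<beta> in at_top. complex_of_real (1 / \<beta>) \<noteq> 0"
      using eventually_gt_at_top[of 0] by eventually_elim simp
    ultimately show ?thesis
      by (simp add: filterlim_at)
  qed
  ultimately have "((\<lambda>\<beta>. g (complex_of_real (1 / \<beta>))) \<longlongrightarrow> a 0) at_top"
    by (rule filterlim_compose)
  moreover have "\<forall>\<^sub>F \<beta> in at_top. g (complex_of_real (1 / \<beta>)) = f \<beta>"
    using sums by eventually_elim (simp add: g_def sums_iff)
  ultimately show ?thesis
    by (rule Lim_transform_eventually)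
qed

lemma system_op_cnj: "cnj (system_op \<alpha> \<eta> \<theta> R \<beta> $ i $ j) = - (system_op \<alpha> \<eta> \<theta> R \<beta> $ i $ j)"
  by (cases i; cases j)
    (simp_all add: system_op_def Omega_mat_def B_mat_def four_blocks_def cscale_def map_matrix_def)

text \<open>Conjugate the eigenvalue equation entrywise: the entries of the matrix are purely
  imaginary, so conjugation only changes their sign.\<close>

lemma system_op_mult_cnj:
  assumes "system_op \<alpha> \<eta> \<theta> R \<beta> *v v = z *s v"
  shows "system_op \<alpha> \<eta> \<theta> R \<beta> *v (\<chi> i. cnj (v $ i)) = (- cnj z) *s (\<chi> i. cnj (v $ i))"
proof -
  let ?A = "system_op \<alpha> \<eta> \<theta> R \<beta>"
  have "(\<Sum>j\<in>UNIV. ?A $ i $ j * cnj (v $ j)) = - cnj z * cnj (v $ i)" for i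
  proof -
    have "(\<Sum>j\<in>UNIV. ?A $ i $ j * cnj (v $ j)) = - cnj ((?A *v v) $ i)"
      by (simp add: matrix_vector_mult_def system_op_cnj sum_negf)
    then show ?thesis
      by (simp add: assms)
  qed
  then show ?thesis
    by (simp add: vec_eq_iff matrix_vector_mult_def)
qed

text \<open>If \<open>\<mu>\<close> differed from every \<open>z\<^sub>j\<close>, then \<open>A - \<mu>\<close> would be surjective, hence injective.\<close>

lemma eigenvalue_in_spanning_family:
  fixes A :: "'a::field^'m^'m"
  assumes "vec.span (w ` J) = UNIV"
    and eig: "\<And>j. j \<in> J \<Longrightarrow> A *v w j = z j *s w j"
    and "A *v v = \<mu> *s v" "v \<noteq> 0"
  shows "\<exists>j\<in>J. \<mu> = z j"
proof (rule ccontr)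
  assume neq: "\<not> (\<exists>j\<in>J. \<mu> = z j)"
  define C where "C = A - mat \<mu>"
  have mat_mult: "mat \<mu> *v x = \<mu> *s x" for x :: "'a^'m"
    by (simp add: vec_eq_iff matrix_vector_mult_def mat_def if_distrib[of "\<lambda>a. a * _"] cong: if_cong)
  have C: "C *v x = A *v x - \<mu> *s x" for x
    by (simp add: C_def matrix_vector_mult_diff_rdistrib mat_mult)
  have "w ` J \<subseteq> range ((*v) C)"
  proof (intro image_subsetI)
    fix j assume j: "j \<in> J"
    \<comment> \<open>\<open>C\<close> multiplies \<open>w j\<close> by the nonzero scalar
      \<open>z j - \<mu>\<close>, so a rescaled \<open>w j\<close> is a preimage of
      \<open>w j\<close>.\<close>
    have "C *v (inverse (z j - \<mu>) *s w j) = inverse (z j - \<mu>) *s ((z j - \<mu>) *s w j)"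
      using eig[OF j] by (simp add: vec.scale C vec.scale_left_diff_distrib)
    also have "\<dots> = w j"
      by (subst vec.scale_scale) (use neq j in auto)
    finally show "w j \<in> range ((*v) C)"
      by (metis rangeI)
  qed
  moreover have "vec.subspace (range ((*v) C))"
    by (simp add: vec.subspace_image)
  ultimately have "surj ((*v) C)"
    using assms(1) vec.span_minimal by blast
  then have "inj ((*v) C)"
    by (rule vec.linear_surj_imp_inj[OF matrix_vector_mul_linear_gen])
  moreover have "C *v v = C *v 0"
    by (simp add: C assms(3))
  ultimately show False
    using \<open>v \<noteq> 0\<close> by (metis injD)
qed

lemma eventually_neq_tendsto:
  fixes f g :: "'a \<Rightarrow> 'b::t2_space"
  assumes "(f \<longlongrightarrow> a) F" "(g \<longlongrightarrow> b) F" "a \<noteq> b"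
  shows "\<forall>\<^sub>F x in F. f x \<noteq> g x"
proof -
  obtain U V where UV: "open U" "open V" "a \<in> U" "b \<in> V" "U \<inter> V = {}"
    using hausdorff[OF \<open>a \<noteq> b\<close>] by blast
  have "\<forall>\<^sub>F x in F. f x \<in> U" "\<forall>\<^sub>F x in F. g x \<in> V"
    using UV assms by (simp_all add: topological_tendstoD)
  then show ?thesis
    by eventually_elim (use UV(5) in auto)
qed

theorem theorem41:
  fixes \<alpha> \<eta> \<theta> R :: "real^'n^'n"
    and b \<rho> :: "nat \<Rightarrow> real"
    and wr :: "nat \<Rightarrow> complex^('n + 'n)"
    and w :: "nat \<Rightarrow> real \<Rightarrow> complex^('n + 'n)"
    and \<zeta> :: "nat \<Rightarrow> real \<Rightarrow> complex"
  assumes "pos_def \<alpha>"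
    and "pos_semidef \<eta>"
    and "transpose \<theta> = - \<theta>"
    and "pos_semidef R"
    and "rank R > 0"
    and "loss_eigensystem \<alpha> \<eta> \<theta> R b \<rho> wr w \<zeta>"
    and "inj_on b {1..rank R}"
  shows "(\<forall>\<^sub>F \<beta> in at_top. \<forall>j\<in>{1..rank R}. Re (\<zeta> j \<beta>) = 0) \<and>
    (mat_ker R \<inter> mat_ker \<eta> = {0} \<longrightarrow>
     (\<forall>j\<in>{rank R + 1..2 * rank R}. \<rho> j = 0) \<longrightarrow>
     (\<forall>j\<in>{2 * rank R + 1..2 * CARD('n)}. \<rho> j \<noteq> 0) \<longrightarrow>
       (\<forall>\<^sub>F \<beta> in at_top. \<forall>j\<in>{2 * rank R + 1..2 * CARD('n)}. Re (\<zeta> j \<beta>) \<noteq> 0) \<and>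
       (\<forall>j\<in>{rank R + 1..2 * rank R}. ((\<lambda>\<beta>. Re (\<zeta> j \<beta>)) \<longlongrightarrow> 0) at_top))"
proof -
  let ?m = "rank R" and ?n = "2 * CARD('n)"
  note les = assms(6)[unfolded loss_eigensystem_def Let_def]
  note les_basis = les[THEN conjunct2, THEN conjunct2, THEN conjunct2, THEN conjunct2]
  note les_high = les_basis[THEN conjunct2, THEN conjunct2]
  have b_pos: "0 < b j" if "j \<in> {1..?m}" for j
    using les[THEN conjunct1] that unfolding enumerates_nonzero_eigenvalues_def by blast
  have basis: "\<forall>\<^sub>F \<beta> in at_top.
      vec.independent ((\<lambda>j. w j \<beta>) ` {1..?n}) \<and> vec.span ((\<lambda>j. w j \<beta>) ` {1..?n}) = UNIV \<and>
      (\<forall>j\<in>{1..?n}. system_op \<alpha> \<eta> \<theta> R \<beta> *v w j \<beta> = \<zeta> j \<beta> *s w j \<beta>)"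
    using les_basis[THEN conjunct1] by (rule eventually_mono) blast
  have high: "((\<lambda>\<beta>. \<zeta> j \<beta> + \<i> * complex_of_real (b j) * complex_of_real \<beta>) \<longlongrightarrow> complex_of_real (\<rho> j))
      at_top" if "j \<in> {1..?m}" for j
    using les_high[THEN conjunct1, THEN bspec, OF that]
    by (auto dest!: expands_in_inverse_powers_tendsto)
  have low: "(\<zeta> j \<longlongrightarrow> complex_of_real (\<rho> j)) at_top" if "j \<in> {?m+1..?n}" for j
    using les_high[THEN conjunct2, THEN bspec, OF that]
    by (auto dest!: expands_in_inverse_powers_tendsto)
  have low_Re: "((\<lambda>\<beta>. Re (\<zeta> j \<beta>)) \<longlongrightarrow> \<rho> j) at_top" if "j \<in> {?m+1..?n}" for j
    using tendsto_Re[OF low[OF that]] by simp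
  \<comment> \<open>This keeps the high-loss indices within \<open>{1..?n}\<close> and makes
    \<open>?m + 1, ..., 2 * ?m\<close> genuine low-loss indices.\<close>
  have "?m \<le> CARD('n)"
    using rank_bound[of R] by simp

  \<comment> \<open>The leading term of every \<open>\<zeta> j\<close> is
    \<open>- \<i> * c j * \<beta>\<close>. The value 0 covers the bounded low-loss eigenvalues, so
    both families are treated alike.\<close>
  define c where "c j = (if j \<le> ?m then b j else 0)" for j
  have zero: "((\<lambda>\<beta>. complex_of_real (inverse \<beta>)) \<longlongrightarrow> 0) at_top"
    using tendsto_of_real_iff[where 'a = complex, of inverse 0 at_top]
      tendsto_inverse_0_at_top[OF filterlim_ident[of "at_top :: real filter"]] by simp
  have scaled: "((\<lambda>\<beta>. \<zeta> j \<beta> * complex_of_real (inverse \<beta>)) \<longlongrightarrow> - \<i> * complex_of_real (c j)) at_top"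
    if "j \<in> {1..?n}" for j
  proof -
    have "((\<lambda>\<beta>. \<zeta> j \<beta> + \<i> * complex_of_real (c j) * complex_of_real \<beta>) \<longlongrightarrow> complex_of_real (\<rho> j)) at_top"
      using high[of j] low[of j] that by (cases "j \<le> ?m") (auto simp: c_def)
    from tendsto_diff[OF tendsto_mult[OF this zero] tendsto_const]
    have "((\<lambda>\<beta>. (\<zeta> j \<beta> + \<i> * complex_of_real (c j) * complex_of_real \<beta>) * complex_of_real (inverse \<beta>)
        - \<i> * complex_of_real (c j)) \<longlongrightarrow> - \<i> * complex_of_real (c j)) at_top"
      by simp
    then show ?thesis
    proof (rule Lim_transform_eventually)
      show "\<forall>\<^sub>F \<beta> in at_top.
          (\<zeta> j \<beta> + \<i> * complex_of_real (c j) * complex_of_real \<beta>) * complex_of_real (inverse \<beta>)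
          - \<i> * complex_of_real (c j) = \<zeta> j \<beta> * complex_of_real (inverse \<beta>)"
        using eventually_gt_at_top[of 0] by eventually_elim (simp add: field_simps)
    qed
  qed
  \<comment> \<open>After division by \<beta> the two sides have the limits
    \<open>- \<i> * c k\<close> and \<open>- \<i> * c j\<close>, the latter being fixed by the
    reflection because it is imaginary.\<close>
  have separated: "\<forall>\<^sub>F \<beta> in at_top. \<zeta> k \<beta> \<noteq> - cnj (\<zeta> j \<beta>)"
    if "j \<in> {1..?m}" "k \<in> {1..?n}" "k \<noteq> j" for j k
  proof -
    \<comment> \<open>For high-loss \<open>k\<close> this is the distinctness of the
      \<open>b j\<close>; for low-loss \<open>k\<close> it is \<open>0 < b j\<close>.\<close>
    have "c k \<noteq> c j"
      using that b_pos[of j] inj_onD[OF assms(7), of k j] by (auto simp: c_def)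
    moreover have "j \<in> {1..?n}"
      using that \<open>?m \<le> CARD('n)\<close> by auto
    then have "((\<lambda>\<beta>. - cnj (\<zeta> j \<beta> * complex_of_real (inverse \<beta>))) \<longlongrightarrow> - \<i> * complex_of_real (c j)) at_top"
      using tendsto_minus[OF tendsto_cnj[OF scaled[of j]]] by simp
    ultimately have "\<forall>\<^sub>F \<beta> in at_top.
        \<zeta> k \<beta> * complex_of_real (inverse \<beta>) \<noteq> - cnj (\<zeta> j \<beta> * complex_of_real (inverse \<beta>))"
      using scaled[OF that(2)] by (intro eventually_neq_tendsto) auto
    then show ?thesis
      by eventually_elim auto
  qed
  have "\<forall>\<^sub>F \<beta> in at_top. Re (\<zeta> j \<beta>) = 0" if j: "j \<in> {1..?m}" for j
  proof -
    \<comment> \<open>Finitely many \<open>k\<close> compete, so one threshold for \<beta> serves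
      them all.\<close>
    have "\<forall>\<^sub>F \<beta> in at_top. \<forall>k\<in>{1..?n} - {j}. \<zeta> k \<beta> \<noteq> - cnj (\<zeta> j \<beta>)"
      using separated[OF j] by (intro eventually_ball_finite) auto
    with basis show ?thesis
    proof eventually_elim
      case (elim \<beta>)
      have jn: "j \<in> {1..?n}"
        using j \<open>?m \<le> CARD('n)\<close> by auto
      have "w j \<beta> \<noteq> 0"
        using elim(1) jn vec.dependent_zero by (metis imageI)
      then have "(\<chi> i. cnj (w j \<beta> $ i)) \<noteq> 0"
        by (simp add: vec_eq_iff)
      moreover have "system_op \<alpha> \<eta> \<theta> R \<beta> *v (\<chi> i. cnj (w j \<beta> $ i))
          = (- cnj (\<zeta> j \<beta>)) *s (\<chi> i. cnj (w j \<beta> $ i))"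
        using elim(1) jn by (intro system_op_mult_cnj) blast
      \<comment> \<open>The reflected value is an eigenvalue, hence occurs in the list; separation
        leaves only \<open>k = j\<close>, and a fixed point of the reflection has real part
        0.\<close>
      ultimately have "\<exists>k\<in>{1..?n}. - cnj (\<zeta> j \<beta>) = \<zeta> k \<beta>"
        using elim(1)
        by (intro eigenvalue_in_spanning_family[where w = "\<lambda>j. w j \<beta>" and A = "system_op \<alpha> \<eta> \<theta> R \<beta>"]) auto
      with elim(2) have "- cnj (\<zeta> j \<beta>) = \<zeta> j \<beta>"
        by (metis Diff_iff singletonD)
      then show ?case
        by (simp add: complex_eq_iff)
    qed
  qed
  then have "\<forall>\<^sub>F \<beta> in at_top. \<forall>j\<in>{1..?m}. Re (\<zeta> j \<beta>) = 0"
    by (intro eventually_ball_finite) auto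
  \<comment> \<open>A function with the nonzero limit \<open>\<rho> j\<close> is eventually nonzero,
    and there are finitely many indices.\<close>
  moreover have "\<forall>\<^sub>F \<beta> in at_top. \<forall>j\<in>{2 * ?m + 1..?n}. Re (\<zeta> j \<beta>) \<noteq> 0"
    if "\<forall>j\<in>{2 * ?m + 1..?n}. \<rho> j \<noteq> 0"
    using that tendsto_imp_eventually_ne[OF low_Re] by (intro eventually_ball_finite) auto
  moreover have "((\<lambda>\<beta>. Re (\<zeta> j \<beta>)) \<longlongrightarrow> 0) at_top"
    if "\<forall>j\<in>{?m + 1..2 * ?m}. \<rho> j = 0" "j \<in> {?m + 1..2 * ?m}" for j
    using that low_Re[of j] \<open>?m \<le> CARD('n)\<close> by simp
  ultimately show ?thesis
    by blast
qed

end
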